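(* In the quaternion algebra $\left(\frac{-1,-1}{\mathbb Q}\right)$ with basis $1,\mathbf i,\mathbf j,\mathbf k$ ($\mathbf i^2=\mathbf j^2=-1$, $\mathbf k=\mathbf i\mathbf j=-\mathbf j\mathbf i$), let $\mathcal G=\mathbb Z\oplus\mathbb Z2\mathbf i\oplus\mathbb Z2\mathbf j\oplus\mathbb Z(\mathbf i+\mathbf k)$. For a positive integer $n$ with $2$-adic valuation $e$, $$r_{\mathcal G}(n)=2\sum_{d\mid n,\ d\text{ odd}}d\cdot\begin{cases}1,&e=0,\\2,&e=1,\\4,&e=2,\\12,&e\ge3.\end{cases}$$
   Context: $r_{\mathcal G}(n)=\#\{\mathbf q\in\mathcal G:\operatorname{nrd}(\mathbf q)=n\}$ where $\operatorname{nrd}(t+x\mathbf i+y\mathbf j+z\mathbf k)=t^2+x^2+y^2+z^2$; the sum is over positive odd divisors $d$ of $n$. *)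

theory Defs
  imports Complex_Main "HOL-Computational_Algebra.Computational_Algebra"
begin

text \<open>The quaternion algebra $(-1,-1)$ over the rationals: \<open>Quat t x y z\<close> stands for
  $t + x i + y j + z k$ (see \<open>Quat_expand\<close> below).\<close>

datatype quat = Quat (qre: rat) (qim1: rat) (qim2: rat) (qim3: rat)

instantiation quat :: ring_1
begin

definition zero_quat :: quat where "0 = Quat 0 0 0 0"

definition one_quat :: quat where "1 = Quat 1 0 0 0"

definition plus_quat :: "quat \<Rightarrow> quat \<Rightarrow> quat" where
  "p + q = Quat (qre p + qre q) (qim1 p + qim1 q) (qim2 p + qim2 q) (qim3 p + qim3 q)"

definition uminus_quat :: "quat \<Rightarrow> quat" where
  "- q = Quat (- qre q) (- qim1 q) (- qim2 q) (- qim3 q)"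

definition minus_quat :: "quat \<Rightarrow> quat \<Rightarrow> quat" where
  "p - q = Quat (qre p - qre q) (qim1 p - qim1 q) (qim2 p - qim2 q) (qim3 p - qim3 q)"

definition times_quat :: "quat \<Rightarrow> quat \<Rightarrow> quat" where
  "p * q = Quat
     (qre p * qre q - qim1 p * qim1 q - qim2 p * qim2 q - qim3 p * qim3 q)
     (qre p * qim1 q + qim1 p * qre q + qim2 p * qim3 q - qim3 p * qim2 q)
     (qre p * qim2 q - qim1 p * qim3 q + qim2 p * qre q + qim3 p * qim1 q)
     (qre p * qim3 q + qim1 p * qim2 q - qim2 p * qim1 q + qim3 p * qre q)"

instance
  by standard
    (auto simp: zero_quat_def one_quat_def plus_quat_def uminus_quat_def minus_quat_def
      times_quat_def algebra_simps)

end

definition qi :: quat where "qi = Quat 0 1 0 0"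

definition qj :: quat where "qj = Quat 0 0 1 0"

definition qk :: quat where "qk = Quat 0 0 0 1"

definition quat_of_rat :: "rat \<Rightarrow> quat" where "quat_of_rat c = Quat c 0 0 0"

lemma quat_basis_mult:
  "qi * qi = - 1" "qj * qj = - 1" "qi * qj = qk" "qj * qi = - qk"
  by (simp_all add: qi_def qj_def qk_def times_quat_def uminus_quat_def one_quat_def)

lemma quat_of_rat_hom:
  "quat_of_rat 1 = 1"
  "quat_of_rat (a + b) = quat_of_rat a + quat_of_rat b"
  "quat_of_rat (a * b) = quat_of_rat a * quat_of_rat b"
  "quat_of_rat a * q = q * quat_of_rat a"
  by (simp_all add: quat_of_rat_def plus_quat_def times_quat_def one_quat_def mult.commute)

lemma Quat_expand:
  "Quat t x y z = quat_of_rat t + quat_of_rat x * qi + quat_of_rat y * qj + quat_of_rat z * qk"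
  by (simp add: quat_of_rat_def qi_def qj_def qk_def plus_quat_def times_quat_def)

definition nrd :: "quat \<Rightarrow> rat" where
  "nrd q = (qre q)\<^sup>2 + (qim1 q)\<^sup>2 + (qim2 q)\<^sup>2 + (qim3 q)\<^sup>2"

definition lattice_G :: "quat set" where
  "lattice_G =
     {of_int a + of_int b * (2 * qi) + of_int c * (2 * qj) + of_int d * (qi + qk) | a b c d. True}"

lemma of_int_quat: "of_int a = Quat (of_int a) 0 0 0"
proof -
  have nat: "of_nat m = Quat (of_nat m) 0 0 0" for m
    by (induction m) (simp_all add: zero_quat_def one_quat_def plus_quat_def)
  show ?thesis
    by (cases a rule: int_diff_cases) (simp add: nat minus_quat_def)
qed

lemma lattice_G_direct_sum:
  assumes "of_int a + of_int b * (2 * qi) + of_int c * (2 * qj) + of_int d * (qi + qk) =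
    of_int a' + of_int b' * (2 * qi) + of_int c' * (2 * qj) + of_int d' * (qi + qk)"
  shows "a = a' \<and> b = b' \<and> c = c' \<and> d = d'"
proof -
  have two: "(2 :: quat) = Quat 2 0 0 0"
    using of_int_quat[of 2] by simp
  show ?thesis
    using assms
    by (simp add: of_int_quat two qi_def qj_def qk_def plus_quat_def times_quat_def)
qed

definition r_G :: "nat \<Rightarrow> nat" where
  "r_G n = card {q \<in> lattice_G. nrd q = of_nat n}"

end

theory Submission
  imports Defs
begin

text \<open>Let \<open>m\<close> be odd. Symmetry of the coordinates shows that the sum of \<open>5 i\<^sup>2 - N\<close> over all
  representations of \<open>N\<close> by five odd squares, with first square \<open>i\<^sup>2\<close>, is zero. This is a recurrence
  for the number of representations of \<open>4 m\<close> by four odd squares. A Liouville-type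
  involution on the solutions of \<open>i\<^sup>2 + 4 a b = N\<close> gives the same recurrence for the sum \<open>s(m)\<close> of
  the divisors of \<open>m\<close>, so that number is \<open>16 s(m)\<close>. Write \<open>r\<close> for the number of
  representations by four squares. The substitution \<open>(x + y, x - y, z + w, z - w)\<close> gives
  \<open>r(2 m) = 3 r(m)\<close> for odd \<open>m\<close> and \<open>r(2 k) = r(k)\<close> for even \<open>k\<close>, and dividing out a common
  factor \<open>2\<close> gives \<open>r(4 m) = 16 s(m) + r(m)\<close>; hence \<open>r(m) = 8 s(m)\<close>. Finally the lattice consists of
  the integer quadruples \<open>(t, x, y, z)\<close> with \<open>y\<close> and \<open>x + z\<close> even, and parity arguments compare
  its counting function with \<open>r\<close>.\<close>

section \<open>A Liouville-type identity on the solutions of i^2 + 4 a b = N\<close>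

definition odd_triples :: "int \<Rightarrow> (int \<times> int \<times> int) set" where
  "odd_triples N = {(i, a, b). odd i \<and> odd a \<and> odd b \<and> a > 0 \<and> b > 0 \<and> i\<^sup>2 + 4 * a * b = N}"

lemma abs_le_square: "\<bar>x\<bar> \<le> x\<^sup>2" for x :: int
proof (cases "x = 0")
  case False
  then have "\<bar>x\<bar> * 1 \<le> \<bar>x\<bar> * \<bar>x\<bar>" by (intro mult_left_mono) auto
  then show ?thesis by (simp add: power2_eq_square)
qed simp

lemma pos_factors_le:
  fixes a b :: int
  assumes "a > 0" "b > 0"
  shows "a \<le> a * b" "b \<le> a * b"
  using mult_left_mono[of 1 b a] mult_right_mono[of 1 a b] assms by simp_all

lemma finite_odd_triples [simp]: "finite (odd_triples N)"
proof (rule finite_subset)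
  show "odd_triples N \<subseteq> {-N..N} \<times> {-N..N} \<times> {-N..N}"
  proof
    fix p assume "p \<in> odd_triples N"
    then obtain i a b where p: "p = (i, a, b)" and ab: "0 < a" "0 < b" and N: "i\<^sup>2 + 4 * (a * b) = N"
      by (auto simp: odd_triples_def mult.assoc)
    have "\<bar>i\<bar> \<le> N" "\<bar>a\<bar> \<le> N" "\<bar>b\<bar> \<le> N"
      using abs_le_square[of i] zero_le_power2[of i] pos_factors_le[OF ab] ab N by linarith+
    then show "p \<in> {-N..N} \<times> {-N..N} \<times> {-N..N}"
      by (auto simp: p)
  qed
qed simp

lemma sum_odd_triples_neg:
  "(\<Sum>(i, a, b)\<in>odd_triples N. f (- i) a b) = (\<Sum>(i, a, b)\<in>odd_triples N. f i a b)"
  by (rule sum.reindex_bij_witness[where i = "\<lambda>(i, a, b). (- i, a, b)" and j = "\<lambda>(i, a, b). (- i, a, b)"])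
    (auto simp: odd_triples_def)

lemma sum_odd_triples_swap:
  "(\<Sum>(i, a, b)\<in>odd_triples N. f i b a) = (\<Sum>(i, a, b)\<in>odd_triples N. f i a b)"
  by (rule sum.reindex_bij_witness[where i = "\<lambda>(i, a, b). (i, b, a)" and j = "\<lambda>(i, a, b). (i, b, a)"])
    (auto simp: odd_triples_def mult_ac)

text \<open>On the part \<open>b + i - a > 0\<close> Zagier's involution \<open>i \<mapsto> 2 a - i\<close> reverses the sign of \<open>i - a\<close>. The
  remaining part is mapped onto \<open>a - b + i > 0\<close>, which is one half of all triples under the
  symmetry \<open>(i, a, b) \<mapsto> (- i, b, a)\<close>.\<close>
lemma liouville_identity:
  "2 * (\<Sum>(i, a, b)\<in>odd_triples N. a\<^sup>2 * (i - a)) =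
   - (\<Sum>(i, a, b)\<in>odd_triples N. (a - b + i)\<^sup>2 * (a + b))"
proof -
  let ?S = "odd_triples N"
  let ?H = "\<lambda>(i, a, b). a\<^sup>2 * (i - a) :: int"
  let ?K = "\<lambda>(i, a, b). (a - b + i)\<^sup>2 * (a + b) :: int"
  define P where "P = {(i, a, b) \<in> ?S. b + i - a > 0}"
  define Q where "Q = {(i, a, b) \<in> ?S. a - i - b > 0}"
  define T where "T = {(i, a, b) \<in> ?S. a - b + i > 0}"
  define T' where "T' = {(i, a, b) \<in> ?S. a - b + i < 0}"
  \<comment> \<open>Both expressions are sums of three odd integers, so the strict inequalities for
    each sign exhaust all triples.\<close>
  have nz: "b + i - a \<noteq> 0" "a - b + i \<noteq> 0" if "(i, a, b) \<in> ?S" for i a b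
  proof -
    from that have "odd (b + i - a)" "odd (a - b + i)" by (auto simp: odd_triples_def)
    then show "b + i - a \<noteq> 0" "a - b + i \<noteq> 0" by (metis even_zero)+
  qed
  have SPQ: "?S = P \<union> Q" "P \<inter> Q = {}" using nz by (force simp: P_def Q_def)+
  have STT: "?S = T \<union> T'" "T \<inter> T' = {}" using nz by (force simp: T_def T'_def)+
  have fin: "finite P" "finite Q" "finite T" "finite T'"
    using finite_odd_triples[of N] SPQ STT by (metis finite_Un)+
  \<comment> \<open>The map preserves i^2 + 4 a b, and the new value of b + i - a is the old b, so
    it keeps P stable and is its own inverse.\<close>
  have "sum ?H P = sum (\<lambda>p. - ?H p) P"
    by (rule sum.reindex_bij_witness[where i = "\<lambda>(i, a, b). (2 * a - i, a, b + i - a)"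
          and j = "\<lambda>(i, a, b). (2 * a - i, a, b + i - a)"])
      (auto simp: P_def odd_triples_def algebra_simps power2_eq_square)
  then have P0: "sum ?H P = 0" by (simp add: sum_negf)
  \<comment> \<open>For the image (i', a', b') = (i + 2 b, a - i - b, b) one gets a' - b' + i' = a
    and a' + b' = a - i, so \<open>?K\<close> of the image is a^2 (a - i), the negative of
    \<open>?H\<close>.\<close>
  have Q0: "sum ?H Q = sum (\<lambda>p. - ?K p) T"
    by (rule sum.reindex_bij_witness[where i = "\<lambda>(i, a, b). (i - 2 * b, a - b + i, b)"
          and j = "\<lambda>(i, a, b). (i + 2 * b, a - i - b, b)"])
      (auto simp: Q_def T_def odd_triples_def algebra_simps power2_eq_square)
  have T0: "sum ?K T = sum ?K T'"
    by (rule sum.reindex_bij_witness[where i = "\<lambda>(i, a, b). (- i, b, a)"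
          and j = "\<lambda>(i, a, b). (- i, b, a)"])
      (auto simp: T'_def T_def odd_triples_def algebra_simps power2_eq_square)
  have "sum ?H ?S = sum ?H P + sum ?H Q"
    using sum.union_disjoint[OF fin(1,2) SPQ(2), of ?H] by (simp only: SPQ(1))
  moreover have "sum ?K ?S = sum ?K T + sum ?K T'"
    using sum.union_disjoint[OF fin(3,4) STT(2), of ?K] by (simp only: STT(1))
  ultimately show ?thesis using P0 Q0 T0 by (simp add: sum_negf)
qed

text \<open>Expanding \<open>liouville_identity\<close>, the terms odd in i vanish under i -> -i,
  and exchanging a and b merges the others in pairs. The cubes of a then cancel, which leaves that
  the sums of i^2 a and of a^2 b agree.\<close>

lemma divisor_recurrence:
  "(\<Sum>(i, a, b)\<in>odd_triples N. a * (i\<^sup>2 - a * b)) = 0"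
proof -
  let ?I = "\<lambda>f. (\<Sum>(i, a, b)\<in>odd_triples N. f i a b :: int)"
  have neg: "?I (\<lambda>i a b. i * a\<^sup>2) = 0" "?I (\<lambda>i a b. i * b\<^sup>2) = 0"
    using sum_odd_triples_neg[of "\<lambda>i a b. i * a\<^sup>2" N] sum_odd_triples_neg[of "\<lambda>i a b. i * b\<^sup>2" N]
    by (simp_all add: split_def sum_negf)
  have swap: "?I (\<lambda>i a b. b ^ 3) = ?I (\<lambda>i a b. a ^ 3)"
      "?I (\<lambda>i a b. b\<^sup>2 * a) = ?I (\<lambda>i a b. a\<^sup>2 * b)"
      "?I (\<lambda>i a b. i\<^sup>2 * b) = ?I (\<lambda>i a b. i\<^sup>2 * a)"
    by (rule sum_odd_triples_swap)+
  have "?I (\<lambda>i a b. a\<^sup>2 * (i - a)) = ?I (\<lambda>i a b. i * a\<^sup>2) - ?I (\<lambda>i a b. a ^ 3)"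
    unfolding sum_subtractf[symmetric]
    by (rule sum.cong) (auto simp: algebra_simps power2_eq_square power3_eq_cube)
  moreover have "?I (\<lambda>i a b. (a - b + i)\<^sup>2 * (a + b)) =
      ?I (\<lambda>i a b. a ^ 3) - ?I (\<lambda>i a b. a\<^sup>2 * b) - ?I (\<lambda>i a b. b\<^sup>2 * a) + ?I (\<lambda>i a b. b ^ 3)
      + ?I (\<lambda>i a b. i\<^sup>2 * a) + ?I (\<lambda>i a b. i\<^sup>2 * b)
      + 2 * ?I (\<lambda>i a b. i * a\<^sup>2) - 2 * ?I (\<lambda>i a b. i * b\<^sup>2)"
    unfolding sum_subtractf[symmetric] sum_distrib_left sum.distrib[symmetric]
    by (rule sum.cong) (auto simp: algebra_simps power2_eq_square power3_eq_cube)
  moreover have "?I (\<lambda>i a b. a * (i\<^sup>2 - a * b)) = ?I (\<lambda>i a b. i\<^sup>2 * a) - ?I (\<lambda>i a b. a\<^sup>2 * b)"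
    unfolding sum_subtractf[symmetric]
    by (rule sum.cong) (auto simp: algebra_simps power2_eq_square)
  ultimately show ?thesis
    using liouville_identity[of N] neg swap by linarith
qed

section \<open>One recurrence for four odd squares and for divisor sums\<close>

definition four_squares :: "int \<Rightarrow> (int \<times> int \<times> int \<times> int) set" where
  "four_squares n = {(x, y, z, w). x\<^sup>2 + y\<^sup>2 + z\<^sup>2 + w\<^sup>2 = n}"

definition four_odd_squares :: "int \<Rightarrow> (int \<times> int \<times> int \<times> int) set" where
  "four_odd_squares n = {(x, y, z, w) \<in> four_squares n. odd x \<and> odd y \<and> odd z \<and> odd w}"

definition odd_factorizations :: "int \<Rightarrow> (int \<times> int) set" where
  "odd_factorizations m = {(a, b). odd a \<and> odd b \<and> a > 0 \<and> b > 0 \<and> a * b = m}"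

definition odd_roots :: "int \<Rightarrow> int set" where
  "odd_roots N = {i. odd i \<and> i\<^sup>2 \<le> N}"

lemma finite_four_squares [simp]: "finite (four_squares n)"
proof (rule finite_subset)
  show "four_squares n \<subseteq> {-n..n} \<times> {-n..n} \<times> {-n..n} \<times> {-n..n}"
  proof (rule subsetI)
    fix p assume "p \<in> four_squares n"
    then obtain x y z w where p: "p = (x, y, z, w)" and n: "x\<^sup>2 + y\<^sup>2 + z\<^sup>2 + w\<^sup>2 = n"
      by (auto simp: four_squares_def)
    have "x\<^sup>2 \<ge> 0" "y\<^sup>2 \<ge> 0" "z\<^sup>2 \<ge> 0" "w\<^sup>2 \<ge> 0" by simp_all
    with n abs_le_square[of x] abs_le_square[of y] abs_le_square[of z] abs_le_square[of w]
    have "\<bar>x\<bar> \<le> n" "\<bar>y\<bar> \<le> n" "\<bar>z\<bar> \<le> n" "\<bar>w\<bar> \<le> n" by linarith+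
    then show "p \<in> {-n..n} \<times> {-n..n} \<times> {-n..n} \<times> {-n..n}"
      by (auto simp: p)
  qed
qed simp

lemma finite_four_odd_squares [simp]: "finite (four_odd_squares n)"
  by (rule finite_subset[OF _ finite_four_squares[of n]]) (auto simp: four_odd_squares_def)

lemma finite_odd_factorizations [simp]: "finite (odd_factorizations m)"
proof (rule finite_subset)
  show "odd_factorizations m \<subseteq> {0..m} \<times> {0..m}"
    by (auto simp: odd_factorizations_def dest: pos_factors_le)
qed simp

lemma finite_odd_roots [simp]: "finite (odd_roots N)"
proof (rule finite_subset)
  show "odd_roots N \<subseteq> {-N..N}"
  proof
    fix i assume "i \<in> odd_roots N"
    with abs_le_square[of i] have "\<bar>i\<bar> \<le> N" by (simp add: odd_roots_def)
    then show "i \<in> {-N..N}" by auto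
  qed
qed simp

text \<open>The modulus 8 fixes a sum of four odd squares modulo 8; the bound on k makes the
  induction in \<open>card_four_odd_squares\<close> descend.\<close>

lemma odd_squareE:
  fixes x :: int
  assumes "odd x"
  obtains k where "x\<^sup>2 = 8 * k + 1" "k \<ge> 0"
proof -
  from assms obtain l where l: "x = 2 * l + 1" by (elim oddE)
  have "even (l * (l + 1))" by simp
  then obtain k where "l * (l + 1) = 2 * k" by (elim evenE)
  then have "x\<^sup>2 = 8 * k + 1" by (simp add: l power2_eq_square algebra_simps)
  moreover from this have "k \<ge> 0" using zero_le_power2[of x] by linarith
  ultimately show ?thesis using that by blast
qed

lemma four_odd_squares_mod_8:
  fixes x y z w :: int
  assumes "odd x" "odd y" "odd z" "odd w"
  shows "(x\<^sup>2 + y\<^sup>2 + z\<^sup>2 + w\<^sup>2) mod 8 = 4"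
proof -
  obtain a b c d where "x\<^sup>2 = 8 * a + 1" "y\<^sup>2 = 8 * b + 1" "z\<^sup>2 = 8 * c + 1" "w\<^sup>2 = 8 * d + 1"
    using assms[THEN odd_squareE] by metis
  then have "x\<^sup>2 + y\<^sup>2 + z\<^sup>2 + w\<^sup>2 = 4 + 8 * (a + b + c + d)" by simp
  then show ?thesis by (simp only: mod_mult_self2) simp
qed

lemma four_odd_squares_recurrence:
  "(\<Sum>i\<in>odd_roots N. (5 * i\<^sup>2 - N) * int (card (four_odd_squares (N - i\<^sup>2)))) = 0"
proof -
  \<comment> \<open>The representations of N by five odd squares, fibred over the first root.
    Exchanging that root with any other coordinate permutes this set, so all five sums of squares
    agree, and together they give N for each element.\<close>
  define W where "W = (SIGMA i:odd_roots N. four_odd_squares (N - i\<^sup>2))"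
  have W: "W = {(i, x, y, z, w). i\<^sup>2 + x\<^sup>2 + y\<^sup>2 + z\<^sup>2 + w\<^sup>2 = N \<and>
      odd i \<and> odd x \<and> odd y \<and> odd z \<and> odd w}"
  proof -
    have "i\<^sup>2 \<le> i\<^sup>2 + x\<^sup>2 + y\<^sup>2 + z\<^sup>2 + w\<^sup>2" for i x y z w :: int by simp
    then show ?thesis
      by (auto simp: W_def odd_roots_def four_odd_squares_def four_squares_def)
  qed
  have x: "(\<Sum>(i, x, y, z, w)\<in>W. x\<^sup>2) = (\<Sum>(i, x, y, z, w)\<in>W. i\<^sup>2)"
    by (rule sum.reindex_bij_witness[where i = "\<lambda>(i, x, y, z, w). (x, i, y, z, w)" and j = "\<lambda>(i, x, y, z, w). (x, i, y, z, w)"])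
      (auto simp: W)
  have y: "(\<Sum>(i, x, y, z, w)\<in>W. y\<^sup>2) = (\<Sum>(i, x, y, z, w)\<in>W. i\<^sup>2)"
    by (rule sum.reindex_bij_witness[where i = "\<lambda>(i, x, y, z, w). (y, x, i, z, w)" and j = "\<lambda>(i, x, y, z, w). (y, x, i, z, w)"])
      (auto simp: W)
  have z: "(\<Sum>(i, x, y, z, w)\<in>W. z\<^sup>2) = (\<Sum>(i, x, y, z, w)\<in>W. i\<^sup>2)"
    by (rule sum.reindex_bij_witness[where i = "\<lambda>(i, x, y, z, w). (z, x, y, i, w)" and j = "\<lambda>(i, x, y, z, w). (z, x, y, i, w)"])
      (auto simp: W)
  have w: "(\<Sum>(i, x, y, z, w)\<in>W. w\<^sup>2) = (\<Sum>(i, x, y, z, w)\<in>W. i\<^sup>2)"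
    by (rule sum.reindex_bij_witness[where i = "\<lambda>(i, x, y, z, w). (w, x, y, z, i)" and j = "\<lambda>(i, x, y, z, w). (w, x, y, z, i)"])
      (auto simp: W)
  have "(\<Sum>(i, x, y, z, w)\<in>W. 5 * i\<^sup>2 - N) = 4 * (\<Sum>(i, x, y, z, w)\<in>W. i\<^sup>2) - (\<Sum>(i, x, y, z, w)\<in>W. x\<^sup>2)
     - (\<Sum>(i, x, y, z, w)\<in>W. y\<^sup>2) - (\<Sum>(i, x, y, z, w)\<in>W. z\<^sup>2) - (\<Sum>(i, x, y, z, w)\<in>W. w\<^sup>2)"
    unfolding sum_subtractf[symmetric] sum_distrib_left
    by (rule sum.cong) (auto simp: W)
  then have "(\<Sum>(i, x, y, z, w)\<in>W. 5 * i\<^sup>2 - N) = 0"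
    using x y z w by simp
  moreover have "(\<Sum>i\<in>odd_roots N. (5 * i\<^sup>2 - N) * int (card (four_odd_squares (N - i\<^sup>2)))) =
      (\<Sum>(i, p)\<in>W. 5 * i\<^sup>2 - N)"
    unfolding W_def by (subst sum.Sigma[symmetric]) (auto simp: mult.commute)
  ultimately show ?thesis by (simp add: split_def)
qed

text \<open>As N and i^2 are both 1 modulo 4, the factorizations of (N - i^2) / 4 form the fibre of
  \<open>odd_triples\<close> over i. On such a triple 5 i^2 - N = 4 (i^2 - a b), which reduces the
  claim to \<open>divisor_recurrence\<close>.\<close>

lemma odd_factorizations_recurrence:
  assumes "N mod 4 = 1"
  shows "(\<Sum>i\<in>odd_roots N. (5 * i\<^sup>2 - N) * (\<Sum>(a, b)\<in>odd_factorizations ((N - i\<^sup>2) div 4). a)) = 0"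
proof -
  define W where "W = (SIGMA i:odd_roots N. odd_factorizations ((N - i\<^sup>2) div 4))"
  have W: "W = odd_triples N"
  proof -
    have dvd: "4 dvd N - i\<^sup>2" if "odd i" for i
    proof -
      from that obtain k where "i\<^sup>2 = 8 * k + 1" by (rule odd_squareE)
      with assms show ?thesis by presburger
    qed
    have "(i, a, b) \<in> W \<longleftrightarrow> (i, a, b) \<in> odd_triples N" for i a b
    proof (cases "odd i \<and> a > 0 \<and> b > 0")
      case True
      \<comment> \<open>Positivity of a b supplies the bound i^2 <= N required by
        \<open>odd_roots\<close>.\<close>
      then have "a * b > 0" by simp
      with dvd[of i] True show ?thesis
        by (auto simp: W_def odd_roots_def odd_factorizations_def odd_triples_def)
    qed (auto simp: W_def odd_roots_def odd_factorizations_def odd_triples_def)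
    then show ?thesis by auto
  qed
  have "(\<Sum>i\<in>odd_roots N. (5 * i\<^sup>2 - N) * (\<Sum>(a, b)\<in>odd_factorizations ((N - i\<^sup>2) div 4). a)) =
      (\<Sum>(i, a, b)\<in>W. (5 * i\<^sup>2 - N) * a)"
    unfolding W_def by (subst sum.Sigma[symmetric]) (auto simp: sum_distrib_left split_def)
  also have "\<dots> = 4 * (\<Sum>(i, a, b)\<in>odd_triples N. a * (i\<^sup>2 - a * b))"
    unfolding W sum_distrib_left
    by (rule sum.cong) (auto simp: odd_triples_def algebra_simps)
  finally show ?thesis by (simp add: divisor_recurrence)
qed

text \<open>Strong induction with N = 4 m + 1: the two recurrences have the same coefficients, the
  roots 1 and -1 contribute the value at m, and all other roots involve smaller arguments. For even
  m both sides vanish modulo 8 considerations, since four odd squares sum to 4 modulo 8.\<close>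

lemma card_four_odd_squares:
  "int (card (four_odd_squares (4 * m))) = 16 * (\<Sum>(a, b)\<in>odd_factorizations m. a)"
proof (induction "nat m" arbitrary: m rule: less_induct)
  case less
  consider "m \<le> 0" | "even m" | "m = 1" | "odd m" "m > 1" by linarith
  then show ?case
  proof cases
    case 1
    have "x\<^sup>2 + y\<^sup>2 + z\<^sup>2 + w\<^sup>2 > 0" if "odd x" for x y z w :: int
      using that by (intro add_pos_nonneg) auto
    with 1 have "x\<^sup>2 + y\<^sup>2 + z\<^sup>2 + w\<^sup>2 \<noteq> 4 * m" if "odd x" for x y z w :: int
      using that by (smt (verit))
    then have "four_odd_squares (4 * m) = {}"
      by (auto simp: four_odd_squares_def four_squares_def)
    moreover have "odd_factorizations m = {}"
      using 1 by (auto simp: odd_factorizations_def dest: mult_pos_pos)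
    ultimately show ?thesis by simp
  next
    case 2
    have "x\<^sup>2 + y\<^sup>2 + z\<^sup>2 + w\<^sup>2 \<noteq> 4 * m" if o: "odd x" "odd y" "odd z" "odd w" for x y z w :: int
      using 2 four_odd_squares_mod_8[OF o] by presburger
    then have "four_odd_squares (4 * m) = {}"
      by (auto simp: four_odd_squares_def four_squares_def)
    moreover have "odd_factorizations m = {}"
      using 2 by (auto simp: odd_factorizations_def)
    ultimately show ?thesis by simp
  next
    case 3
    \<comment> \<open>For m = 1 the leading coefficient 5 - N is zero, so the recurrence says
      nothing and the 16 sign choices are listed directly.\<close>
    have "four_odd_squares 4 = {-1, 1} \<times> {-1, 1} \<times> {-1, 1} \<times> {-1, 1}" (is "_ = ?B")
    proof
      show "?B \<subseteq> four_odd_squares 4" by (auto simp: four_odd_squares_def four_squares_def)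
      show "four_odd_squares 4 \<subseteq> ?B"
      proof
        fix p assume "p \<in> four_odd_squares 4"
        then obtain x y z w where p: "p = (x, y, z, w)" and eq: "x\<^sup>2 + y\<^sup>2 + z\<^sup>2 + w\<^sup>2 = 4"
          and o: "odd x" "odd y" "odd z" "odd w"
          by (auto simp: four_odd_squares_def four_squares_def)
        have ge: "v\<^sup>2 \<ge> 1" if "odd v" for v :: int
          using odd_squareE[OF that] by (metis add_increasing mult_nonneg_nonneg zero_le_numeral order_refl)
        have "x\<^sup>2 = 1" "y\<^sup>2 = 1" "z\<^sup>2 = 1" "w\<^sup>2 = 1"
          using eq o[THEN ge] by linarith+
        then show "p \<in> ?B" unfolding p power2_eq_1_iff by blast
      qed
    qed
    moreover have "odd_factorizations 1 = {(1, 1)}"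
      by (auto simp: odd_factorizations_def zmult_eq_1_iff)
    ultimately show ?thesis using 3 by (simp add: card_cartesian_product)
  next
    case 4
    define N where "N = 4 * m + 1"
    \<comment> \<open>The defect between the two sides at (N - i^2) / 4; it satisfies the common
      recurrence and is to vanish at i = 1.\<close>
    define D where "D i = int (card (four_odd_squares (N - i\<^sup>2))) -
        16 * (\<Sum>(a, b)\<in>odd_factorizations ((N - i\<^sup>2) div 4). a)" for i
    have "N mod 4 = 1" unfolding N_def by presburger
    from odd_factorizations_recurrence[OF this] four_odd_squares_recurrence[of N]
    have sum0: "(\<Sum>i\<in>odd_roots N. (5 * i\<^sup>2 - N) * D i) = 0"
      by (simp add: D_def right_diff_distrib sum_subtractf mult.left_commute flip: sum_distrib_left)
    have D0: "D i = 0" if "i \<in> odd_roots N - {-1, 1}" for i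
    proof -
      have i: "odd i" "i \<noteq> 1" "i \<noteq> -1" using that by (auto simp: odd_roots_def)
      from i(1) obtain k where k: "i\<^sup>2 = 8 * k + 1" "k \<ge> 0" by (rule odd_squareE)
      have "i\<^sup>2 \<noteq> 1" using i by (simp add: power2_eq_1_iff)
      define m' where "m' = m - 2 * k"
      from k 4 \<open>i\<^sup>2 \<noteq> 1\<close> have "nat m' < nat m" by (simp add: m'_def)
      then have "int (card (four_odd_squares (4 * m'))) = 16 * (\<Sum>(a, b)\<in>odd_factorizations m'. a)"
        by (rule less)
      moreover have "N - i\<^sup>2 = 4 * m'" using k by (simp add: N_def m'_def)
      ultimately show ?thesis by (simp add: D_def)
    qed
    have sub: "{-1, 1} \<subseteq> odd_roots N" using 4 by (auto simp: odd_roots_def N_def)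
    have "(\<Sum>i\<in>odd_roots N. (5 * i\<^sup>2 - N) * D i) = (\<Sum>i\<in>{-1, 1}. (5 * i\<^sup>2 - N) * D i)"
      by (rule sum.mono_neutral_right) (use sub D0 in auto)
    \<comment> \<open>\<open>D\<close> depends only on i^2, so the two remaining terms coincide.
      Their coefficient 5 - N = 4 (1 - m) is nonzero because m > 1.\<close>
    also have "\<dots> = 2 * (5 - N) * D 1" by (simp add: D_def)
    finally have "D 1 = 0" using sum0 4 by (simp add: N_def)
    then show ?thesis by (simp add: D_def N_def)
  qed
qed

section \<open>Four squares: parity classes, doubling, and Jacobi's formula for odd m\<close>

definition four_squares_where :: "int \<Rightarrow> (int \<Rightarrow> int \<Rightarrow> int \<Rightarrow> int \<Rightarrow> bool) \<Rightarrow> (int \<times> int \<times> int \<times> int) set" where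
  "four_squares_where n P = {(x, y, z, w) \<in> four_squares n. P x y z w}"

lemma mem_four_squares_where:
  "(x, y, z, w) \<in> four_squares_where n P \<longleftrightarrow> x\<^sup>2 + y\<^sup>2 + z\<^sup>2 + w\<^sup>2 = n \<and> P x y z w"
  by (simp add: four_squares_where_def four_squares_def)

lemma finite_four_squares_where [simp]: "finite (four_squares_where n P)"
  by (rule finite_subset[OF _ finite_four_squares[of n]]) (auto simp: four_squares_where_def)

lemma four_squares_where_cong:
  assumes "\<And>x y z w. x\<^sup>2 + y\<^sup>2 + z\<^sup>2 + w\<^sup>2 = n \<Longrightarrow> P x y z w \<longleftrightarrow> Q x y z w"
  shows "four_squares_where n P = four_squares_where n Q"
  using assms by (auto simp: mem_four_squares_where)

lemma four_squares_eq_where: "four_squares n = four_squares_where n (\<lambda>x y z w. True)"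
  by (auto simp: four_squares_where_def)

lemma four_odd_squares_eq_where:
  "four_odd_squares n = four_squares_where n (\<lambda>x y z w. odd x \<and> odd y \<and> odd z \<and> odd w)"
  by (auto simp: four_squares_where_def four_odd_squares_def)

lemma card_four_squares_where_disj:
  assumes "\<And>x y z w. x\<^sup>2 + y\<^sup>2 + z\<^sup>2 + w\<^sup>2 = n \<Longrightarrow> \<not> (P x y z w \<and> Q x y z w)"
  shows "card (four_squares_where n (\<lambda>x y z w. P x y z w \<or> Q x y z w)) =
    card (four_squares_where n P) + card (four_squares_where n Q)"
  by (subst card_Un_disjoint[symmetric])
    (use assms in \<open>auto simp: mem_four_squares_where intro!: arg_cong[where f = card]\<close>)

lemma
  shows card_swap_12: "card (four_squares_where n (\<lambda>x y z w. P y x z w)) = card (four_squares_where n P)"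
    and card_swap_13: "card (four_squares_where n (\<lambda>x y z w. P z y x w)) = card (four_squares_where n P)"
    and card_swap_23: "card (four_squares_where n (\<lambda>x y z w. P x z y w)) = card (four_squares_where n P)"
    and card_swap_24: "card (four_squares_where n (\<lambda>x y z w. P x w z y)) = card (four_squares_where n P)"
    and card_swap_34: "card (four_squares_where n (\<lambda>x y z w. P x y w z)) = card (four_squares_where n P)"
proof -
  show "card (four_squares_where n (\<lambda>x y z w. P y x z w)) = card (four_squares_where n P)"
    by (rule bij_betw_same_card[OF bij_betw_byWitness[where f = "\<lambda>(x, y, z, w). (y, x, z, w)"
      and f' = "\<lambda>(x, y, z, w). (y, x, z, w)"]]) (auto simp: mem_four_squares_where)
  show "card (four_squares_where n (\<lambda>x y z w. P z y x w)) = card (four_squares_where n P)"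
    by (rule bij_betw_same_card[OF bij_betw_byWitness[where f = "\<lambda>(x, y, z, w). (z, y, x, w)"
      and f' = "\<lambda>(x, y, z, w). (z, y, x, w)"]]) (auto simp: mem_four_squares_where)
  show "card (four_squares_where n (\<lambda>x y z w. P x z y w)) = card (four_squares_where n P)"
    by (rule bij_betw_same_card[OF bij_betw_byWitness[where f = "\<lambda>(x, y, z, w). (x, z, y, w)"
      and f' = "\<lambda>(x, y, z, w). (x, z, y, w)"]]) (auto simp: mem_four_squares_where)
  show "card (four_squares_where n (\<lambda>x y z w. P x w z y)) = card (four_squares_where n P)"
    by (rule bij_betw_same_card[OF bij_betw_byWitness[where f = "\<lambda>(x, y, z, w). (x, w, z, y)"
      and f' = "\<lambda>(x, y, z, w). (x, w, z, y)"]]) (auto simp: mem_four_squares_where)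
  show "card (four_squares_where n (\<lambda>x y z w. P x y w z)) = card (four_squares_where n P)"
    by (rule bij_betw_same_card[OF bij_betw_byWitness[where f = "\<lambda>(x, y, z, w). (x, y, w, z)"
      and f' = "\<lambda>(x, y, z, w). (x, y, w, z)"]]) (auto simp: mem_four_squares_where)
qed

text \<open>Squares are 0 or 1 modulo 4, so the sum determines the number of odd coordinates modulo
  4. The later parity arguments for even sums rest on this count.\<close>

lemma sum_four_squares_mod_4:
  fixes x y z w :: int
  shows "(x\<^sup>2 + y\<^sup>2 + z\<^sup>2 + w\<^sup>2) mod 4 =
    (of_bool (odd x) + of_bool (odd y) + of_bool (odd z) + of_bool (odd w)) mod 4"
proof -
  have sq: "\<exists>k. v\<^sup>2 = of_bool (odd v) + 4 * k" for v :: int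
  proof (cases "even v")
    case True
    then obtain u where "v = 2 * u" by (elim evenE)
    then show ?thesis by (auto simp: power2_eq_square)
  next
    case False
    then obtain k where "v\<^sup>2 = 8 * k + 1" by (rule odd_squareE)
    with False show ?thesis by (intro exI[of _ "2 * k"]) simp
  qed
  obtain a b c d where "x\<^sup>2 = of_bool (odd x) + 4 * a" "y\<^sup>2 = of_bool (odd y) + 4 * b"
      "z\<^sup>2 = of_bool (odd z) + 4 * c" "w\<^sup>2 = of_bool (odd w) + 4 * d"
    using sq by metis
  then have "x\<^sup>2 + y\<^sup>2 + z\<^sup>2 + w\<^sup>2 =
      of_bool (odd x) + of_bool (odd y) + of_bool (odd z) + of_bool (odd w) + 4 * (a + b + c + d)"
    by simp
  then show ?thesis by (simp only: mod_mult_self2)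
qed

text \<open>The substitution (x + y, x - y, z + w, z - w) doubles the sum of squares, and its image
  is cut out by equal parity within each of the two pairs. \<open>Q\<close> carries further
  conditions through the substitution.\<close>

lemma card_four_squares_pairwise_even:
  "card (four_squares_where (2 * k) (\<lambda>x y z w. even (x + y) \<and> even (z + w) \<and> Q x y z w)) =
   card (four_squares_where k (\<lambda>x y z w. Q (x + y) (x - y) (z + w) (z - w)))"
  (is "card ?A = card ?B")
proof -
  define f :: "int \<times> int \<times> int \<times> int \<Rightarrow> int \<times> int \<times> int \<times> int" where
    "f = (\<lambda>(x, y, z, w). (x + y, x - y, z + w, z - w))"
  have "?A = f ` ?B"
  proof (intro subset_antisym subsetI)
    fix p assume "p \<in> ?A"
    then obtain x y z w where p: "p = (x, y, z, w)" and n: "x\<^sup>2 + y\<^sup>2 + z\<^sup>2 + w\<^sup>2 = 2 * k"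
      and ev: "even (x + y)" "even (z + w)" and Q: "Q x y z w"
      by (cases p) (auto simp: mem_four_squares_where)
    from ev obtain c d where "x + y = 2 * c" "z + w = 2 * d" by (elim evenE)
    then have x: "x = 2 * c - y" and z: "z = 2 * d - w" by simp_all
    have "p = f (c, c - y, d, d - w)" by (simp add: f_def p x z)
    moreover have "(c, c - y, d, d - w) \<in> ?B"
      using n Q by (simp add: mem_four_squares_where x z power2_eq_square algebra_simps)
    ultimately show "p \<in> f ` ?B" by blast
  next
    fix p assume "p \<in> f ` ?B"
    then show "p \<in> ?A"
      by (auto simp: f_def mem_four_squares_where power2_eq_square algebra_simps)
  qed
  moreover have "inj_on f ?B" by (auto simp: inj_on_def f_def)
  ultimately show ?thesis by (simp add: card_image)
qed

lemma card_four_squares_all_even: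
  "card (four_squares_where (4 * k) (\<lambda>x y z w. even x \<and> even y \<and> even z \<and> even w)) =
   card (four_squares k)"
  (is "card ?A = _")
proof -
  define f :: "int \<times> int \<times> int \<times> int \<Rightarrow> int \<times> int \<times> int \<times> int" where
    "f = (\<lambda>(x, y, z, w). (2 * x, 2 * y, 2 * z, 2 * w))"
  have "?A = f ` four_squares k"
  proof (intro subset_antisym subsetI)
    fix p assume "p \<in> ?A"
    then obtain x y z w where p: "p = (2 * x, 2 * y, 2 * z, 2 * w)"
      and n: "(2 * x)\<^sup>2 + (2 * y)\<^sup>2 + (2 * z)\<^sup>2 + (2 * w)\<^sup>2 = 4 * k"
      by (cases p) (auto simp: mem_four_squares_where elim!: evenE)
    then have "p = f (x, y, z, w)" "(x, y, z, w) \<in> four_squares k"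
      by (auto simp: f_def four_squares_def power_mult_distrib)
    then show "p \<in> f ` four_squares k" by blast
  next
    fix p assume "p \<in> f ` four_squares k"
    then show "p \<in> ?A"
      by (auto simp: f_def four_squares_def mem_four_squares_where power_mult_distrib)
  qed
  moreover have "inj_on f (four_squares k)" by (auto simp: inj_on_def f_def)
  ultimately show ?thesis by (simp add: card_image)
qed

text \<open>A sum divisible by 4 has zero or four odd coordinates, so every representation lies in
  the image of the doubling substitution.\<close>

lemma card_four_squares_double_even:
  assumes "even k"
  shows "card (four_squares (2 * k)) = card (four_squares k)"
proof -
  have "even (x + y) \<and> even (z + w)" if "x\<^sup>2 + y\<^sup>2 + z\<^sup>2 + w\<^sup>2 = 2 * k" for x y z w
  proof -
    from assms have "2 * k mod 4 = 0" by (elim evenE) simp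
    with sum_four_squares_mod_4[of x y z w] that show ?thesis
      by (cases "even x"; cases "even y"; cases "even z"; cases "even w"; simp)
  qed
  then have "four_squares (2 * k) =
      four_squares_where (2 * k) (\<lambda>x y z w. even (x + y) \<and> even (z + w) \<and> True)"
    unfolding four_squares_eq_where by (intro four_squares_where_cong) simp
  then show ?thesis
    by (simp only: card_four_squares_pairwise_even four_squares_eq_where[of k])
qed

text \<open>A sum that is 2 modulo 4 has exactly two odd coordinates, so exactly one of the three
  ways to pair the coordinates matches parities. Each pairing contributes the number of
  representations of m.\<close>

lemma card_four_squares_double_odd:
  assumes "odd m"
  shows "card (four_squares (2 * m)) = 3 * card (four_squares m)"
proof -
  let ?P = "\<lambda>x y z w :: int. even (x + y) \<and> even (z + w)"
  let ?Q = "\<lambda>x y z w :: int. even (x + z) \<and> even (y + w)"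
  let ?R = "\<lambda>x y z w :: int. even (x + w) \<and> even (z + y)"
  let ?c = "\<lambda>P. card (four_squares_where (2 * m) P)"
  have parity: "(?P x y z w \<or> ?Q x y z w \<or> ?R x y z w) \<and> \<not> (?P x y z w \<and> ?Q x y z w) \<and>
      \<not> (?P x y z w \<and> ?R x y z w) \<and> \<not> (?Q x y z w \<and> ?R x y z w)"
    if "x\<^sup>2 + y\<^sup>2 + z\<^sup>2 + w\<^sup>2 = 2 * m" for x y z w
  proof -
    from assms have "2 * m mod 4 = 2" by (elim oddE) (simp add: mod_mult_self2)
    with sum_four_squares_mod_4[of x y z w] that show ?thesis
      by (cases "even x"; cases "even y"; cases "even z"; cases "even w"; simp)
  qed
  have "card (four_squares (2 * m)) = ?c (\<lambda>x y z w. ?P x y z w \<or> ?Q x y z w \<or> ?R x y z w)"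
    unfolding four_squares_eq_where
    by (rule arg_cong[where f = card], rule four_squares_where_cong, drule parity, argo)
  moreover have "?c (\<lambda>x y z w. ?P x y z w \<or> ?Q x y z w \<or> ?R x y z w) =
      ?c ?P + ?c (\<lambda>x y z w. ?Q x y z w \<or> ?R x y z w)"
    by (rule card_four_squares_where_disj, drule parity, argo)
  moreover have "?c (\<lambda>x y z w. ?Q x y z w \<or> ?R x y z w) = ?c ?Q + ?c ?R"
    by (rule card_four_squares_where_disj, drule parity, argo)
  moreover have "?c ?Q = ?c ?P" by (rule card_swap_23)
  moreover have "?c ?R = ?c ?P" by (rule card_swap_24)
  moreover have "?c ?P = card (four_squares m)"
    using card_four_squares_pairwise_even[of m "\<lambda>x y z w. True"] by (simp add: four_squares_eq_where)
  ultimately show ?thesis by linarith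
qed

text \<open>With r and s as in the overview, r(4 m) is 16 s(m) + r(m) by splitting into all odd and
  all even, and 3 r(m) by doubling twice.\<close>

lemma card_four_squares_odd:
  assumes "odd m"
  shows "int (card (four_squares m)) = 8 * (\<Sum>(a, b)\<in>odd_factorizations m. a)"
proof -
  let ?O = "\<lambda>x y z w :: int. odd x \<and> odd y \<and> odd z \<and> odd w"
  let ?E = "\<lambda>x y z w :: int. even x \<and> even y \<and> even z \<and> even w"
  have parity: "?O x y z w \<or> ?E x y z w" if "x\<^sup>2 + y\<^sup>2 + z\<^sup>2 + w\<^sup>2 = 4 * m" for x y z w
    using sum_four_squares_mod_4[of x y z w] that
    by (cases "even x"; cases "even y"; cases "even z"; cases "even w"; simp)
  have "four_squares (4 * m) = four_squares_where (4 * m) (\<lambda>x y z w. ?O x y z w \<or> ?E x y z w)"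
    unfolding four_squares_eq_where using parity by (intro four_squares_where_cong) simp
  also have "card \<dots> = card (four_odd_squares (4 * m)) + card (four_squares m)"
    by (subst card_four_squares_where_disj)
      (auto simp: four_odd_squares_eq_where card_four_squares_all_even)
  finally have "card (four_squares (4 * m)) = card (four_odd_squares (4 * m)) + card (four_squares m)" .
  moreover have "card (four_squares (4 * m)) = 3 * card (four_squares m)"
    using card_four_squares_double_even[of "2 * m"] card_four_squares_double_odd[OF assms] by simp
  ultimately show ?thesis using card_four_odd_squares[of m] by linarith
qed

lemma card_four_squares_even:
  assumes "odd m"
  shows "card (four_squares (2 ^ Suc j * m)) = 3 * card (four_squares m)"
proof (induction j)
  case 0
  show ?case using card_four_squares_double_odd[OF assms] by simp
next
  case (Suc j)
  show ?case using card_four_squares_double_even[of "2 ^ Suc j * m"] Suc by (simp add: mult.assoc)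
qed

section \<open>The lattice count in terms of four squares\<close>

lemma r_G_eq_card:
  "r_G n = card (four_squares_where (int n) (\<lambda>x y z w. even z \<and> even (y + w)))"
  (is "_ = card ?A")
proof -
  define f where "f = (\<lambda>(x, y, z, w). Quat (of_int x) (of_int y) (of_int z) (of_int w))"
  have two: "(2 :: quat) = Quat 2 0 0 0"
    using of_int_quat[of 2] by simp
  \<comment> \<open>These coordinates give the parity description: the third is even, and the second
    and fourth differ by the even number 2 b.\<close>
  have coords: "of_int a + of_int b * (2 * qi) + of_int c * (2 * qj) + of_int d * (qi + qk) =
      f (a, 2 * b + d, 2 * c, d)" for a b c d
    by (simp add: f_def of_int_quat two qi_def qj_def qk_def plus_quat_def times_quat_def mult.commute)
  have nrd: "nrd (f (x, y, z, w)) = of_nat n \<longleftrightarrow> x\<^sup>2 + y\<^sup>2 + z\<^sup>2 + w\<^sup>2 = int n" for x y z w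
  proof -
    have "nrd (f (x, y, z, w)) = of_int (x\<^sup>2 + y\<^sup>2 + z\<^sup>2 + w\<^sup>2)" by (simp add: nrd_def f_def)
    moreover have "of_nat n = (of_int (int n) :: rat)" by simp
    ultimately show ?thesis by (metis of_int_eq_iff)
  qed
  have "{q \<in> lattice_G. nrd q = of_nat n} = f ` ?A"
  proof (intro subset_antisym subsetI)
    fix q assume "q \<in> {q \<in> lattice_G. nrd q = of_nat n}"
    then obtain a b c d where q: "q = f (a, 2 * b + d, 2 * c, d)" and "nrd q = of_nat n"
      by (auto simp: lattice_G_def coords)
    then have "(a, 2 * b + d, 2 * c, d) \<in> ?A" by (simp add: nrd mem_four_squares_where)
    with q show "q \<in> f ` ?A" by blast
  next
    fix q assume "q \<in> f ` ?A"
    then obtain x y z w where q: "q = f (x, y, z, w)" and n: "x\<^sup>2 + y\<^sup>2 + z\<^sup>2 + w\<^sup>2 = int n"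
      and "even z" "even (y + w)"
      by (auto simp: mem_four_squares_where)
    moreover from this have "even (y - w)" by simp
    ultimately obtain b c where z: "z = 2 * c" and "y - w = 2 * b" by (elim evenE)
    then have "y = 2 * b + w" by simp
    with z have "q = f (x, 2 * b + w, 2 * c, w)" by (simp add: q)
    then have "q \<in> lattice_G" unfolding lattice_G_def coords by blast
    with n show "q \<in> {q \<in> lattice_G. nrd q = of_nat n}" by (simp add: q nrd)
  qed
  moreover have "inj_on f ?A" by (auto simp: inj_on_def f_def)
  ultimately show ?thesis by (simp add: r_G_def card_image)
qed

text \<open>An odd sum makes exactly one of the pairs (x, z) and (y, w) mixed in parity. Which pair
  it is, and which of its members is even, gives four disjoint classes; coordinate swaps carry each
  to the lattice condition \<open>?P\<close>.\<close>

lemma r_G_odd: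
  assumes "odd m"
  shows "4 * r_G m = card (four_squares (int m))"
proof -
  let ?P = "\<lambda>x y z w :: int. even z \<and> even (y + w)"
  let ?Q = "\<lambda>x y z w :: int. even x \<and> even (y + w)"
  let ?R = "\<lambda>x y z w :: int. even w \<and> even (x + z)"
  let ?S = "\<lambda>x y z w :: int. even y \<and> even (x + z)"
  let ?c = "\<lambda>P. card (four_squares_where (int m) P)"
  have parity: "(?P x y z w \<or> ?Q x y z w \<or> ?R x y z w \<or> ?S x y z w) \<and> \<not> (?P x y z w \<and> ?Q x y z w) \<and>
      \<not> (?P x y z w \<and> ?R x y z w) \<and> \<not> (?P x y z w \<and> ?S x y z w) \<and> \<not> (?Q x y z w \<and> ?R x y z w) \<and>
      \<not> (?Q x y z w \<and> ?S x y z w) \<and> \<not> (?R x y z w \<and> ?S x y z w)"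
    if "x\<^sup>2 + y\<^sup>2 + z\<^sup>2 + w\<^sup>2 = int m" for x y z w
  proof -
    from assms that have "odd (x\<^sup>2 + y\<^sup>2 + z\<^sup>2 + w\<^sup>2)" by simp
    then show ?thesis by simp blast
  qed
  have "card (four_squares (int m)) =
      ?c (\<lambda>x y z w. ?P x y z w \<or> ?Q x y z w \<or> ?R x y z w \<or> ?S x y z w)"
    unfolding four_squares_eq_where
    by (rule arg_cong[where f = card], rule four_squares_where_cong, drule parity, argo)
  moreover have "?c (\<lambda>x y z w. ?P x y z w \<or> ?Q x y z w \<or> ?R x y z w \<or> ?S x y z w) =
      ?c ?P + ?c (\<lambda>x y z w. ?Q x y z w \<or> ?R x y z w \<or> ?S x y z w)"
    by (rule card_four_squares_where_disj, drule parity, argo)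
  moreover have "?c (\<lambda>x y z w. ?Q x y z w \<or> ?R x y z w \<or> ?S x y z w) =
      ?c ?Q + ?c (\<lambda>x y z w. ?R x y z w \<or> ?S x y z w)"
    by (rule card_four_squares_where_disj, drule parity, argo)
  moreover have "?c (\<lambda>x y z w. ?R x y z w \<or> ?S x y z w) = ?c ?R + ?c ?S"
    by (rule card_four_squares_where_disj, drule parity, argo)
  moreover have "?c ?S = ?c ?R" using card_swap_24[of "int m" ?R] by simp
  moreover have "?c ?R = ?c ?P"
  proof -
    have "?c ?R = ?c (\<lambda>x y z w. even w \<and> even (y + z))" by (rule card_swap_12[symmetric])
    also have "\<dots> = ?c ?P" by (rule card_swap_34)
    finally show ?thesis .
  qed
  moreover have "?c ?Q = ?c ?P" by (rule card_swap_13)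
  ultimately show ?thesis unfolding r_G_eq_card by linarith
qed

text \<open>For an even sum the lattice condition forces x to be even as well, so the doubling
  substitution applies to the pairs (x, z) and (y, w) and turns "x even" into "x + y even". For odd
  m exactly one of x + y and z + w is even, and symmetry makes this half of all
  representations.\<close>

lemma r_G_double_odd:
  assumes "odd m"
  shows "2 * r_G (2 * m) = card (four_squares (int m))"
proof -
  let ?P = "\<lambda>x y z w :: int. even (x + y)"
  let ?Q = "\<lambda>x y z w :: int. even (z + w)"
  let ?c = "\<lambda>P. card (four_squares_where (int m) P)"
  have "r_G (2 * m) = card (four_squares_where (2 * int m) (\<lambda>x y z w. even (x + z) \<and> even (y + w) \<and> even x))"
  proof -
    have "even z \<and> even (y + w) \<longleftrightarrow> even (x + z) \<and> even (y + w) \<and> even x"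
      if "x\<^sup>2 + y\<^sup>2 + z\<^sup>2 + w\<^sup>2 = 2 * int m" for x y z w
    proof -
      have "even (x\<^sup>2 + y\<^sup>2 + z\<^sup>2 + w\<^sup>2)" by (simp add: that)
      then show ?thesis by simp blast
    qed
    then have "four_squares_where (2 * int m) (\<lambda>x y z w. even z \<and> even (y + w)) =
        four_squares_where (2 * int m) (\<lambda>x y z w. even (x + z) \<and> even (y + w) \<and> even x)"
      by (rule four_squares_where_cong)
    then show ?thesis by (simp only: r_G_eq_card of_nat_mult of_nat_numeral)
  qed
  also have "\<dots> = card (four_squares_where (2 * int m) (\<lambda>x y z w. even (x + y) \<and> even (z + w) \<and> even x))"
    by (rule card_swap_23)
  also have "\<dots> = ?c ?P" by (rule card_four_squares_pairwise_even)
  finally have *: "r_G (2 * m) = ?c ?P" .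
  have parity: "(?P x y z w \<or> ?Q x y z w) \<and> \<not> (?P x y z w \<and> ?Q x y z w)"
    if "x\<^sup>2 + y\<^sup>2 + z\<^sup>2 + w\<^sup>2 = int m" for x y z w
  proof -
    from assms that have "odd (x\<^sup>2 + y\<^sup>2 + z\<^sup>2 + w\<^sup>2)" by simp
    then show ?thesis by simp blast
  qed
  have "card (four_squares (int m)) = ?c (\<lambda>x y z w. ?P x y z w \<or> ?Q x y z w)"
    unfolding four_squares_eq_where
    by (rule arg_cong[where f = card], rule four_squares_where_cong, drule parity, argo)
  moreover have "?c (\<lambda>x y z w. ?P x y z w \<or> ?Q x y z w) = ?c ?P + ?c ?Q"
    by (rule card_four_squares_where_disj, drule parity, argo)
  moreover have "?c ?Q = ?c ?P"
  proof -
    have "?c ?Q = ?c (\<lambda>x y z w. even (x + w))" by (rule card_swap_13[symmetric])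
    also have "\<dots> = ?c ?P" by (rule card_swap_24)
    finally show ?thesis .
  qed
  ultimately show ?thesis using * by linarith
qed

text \<open>Zero or four coordinates are odd, and the even z excludes four; dividing by 2 gives all
  representations of k.\<close>

lemma r_G_quadruple: "r_G (4 * k) = card (four_squares (int k))"
proof -
  have "even z \<and> even (y + w) \<longleftrightarrow> even x \<and> even y \<and> even z \<and> even w"
    if "x\<^sup>2 + y\<^sup>2 + z\<^sup>2 + w\<^sup>2 = 4 * int k" for x y z w
    using sum_four_squares_mod_4[of x y z w] that
    by (cases "even x"; cases "even y"; cases "even z"; cases "even w"; simp)
  then have "four_squares_where (4 * int k) (\<lambda>x y z w. even z \<and> even (y + w)) =
      four_squares_where (4 * int k) (\<lambda>x y z w. even x \<and> even y \<and> even z \<and> even w)"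
    by (rule four_squares_where_cong)
  then show ?thesis
    by (simp only: r_G_eq_card of_nat_mult of_nat_numeral card_four_squares_all_even)
qed

section \<open>Divisor sums and the cases of the 2-adic valuation\<close>

lemma sum_odd_factorizations:
  assumes "odd m"
  shows "(\<Sum>(a, b)\<in>odd_factorizations (int m). a) = int (\<Sum>d | d dvd m. d)"
  unfolding of_nat_sum
proof (rule sum.reindex_bij_witness[where j = "\<lambda>(a, b). nat a" and i = "\<lambda>d. (int d, int (m div d))"])
  fix p assume p: "p \<in> odd_factorizations (int m)"
  then obtain a b where ab: "p = (int a, int b)" "a > 0" "b > 0" "int a * int b = int m"
    by (auto simp: odd_factorizations_def dest!: pos_int_cases elim!: pos_int_cases)
  then have m: "m = a * b" by (metis of_nat_eq_iff of_nat_mult)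
  show "(int (case p of (a, b) \<Rightarrow> nat a), int (m div (case p of (a, b) \<Rightarrow> nat a))) = p"
    "(case p of (a, b) \<Rightarrow> nat a) \<in> {d. d dvd m}"
    "int (case p of (a, b) \<Rightarrow> nat a) = (case p of (a, b) \<Rightarrow> a)"
    using ab by (auto simp: m)
next
  fix d assume "d \<in> {d. d dvd m}"
  then obtain b where m: "m = d * b" by auto
  \<comment> \<open>Oddness of m passes to both factors, so every divisor comes from an odd
    factorization.\<close>
  with assms have "odd d" "odd b" by auto
  then have "d > 0" "b > 0" by (auto intro: odd_pos)
  with \<open>odd d\<close> \<open>odd b\<close> show "(int d, int (m div d)) \<in> odd_factorizations (int m)"
    by (simp add: odd_factorizations_def m)
  show "(case (int d, int (m div d)) of (a, b) \<Rightarrow> nat a) = d" by simp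
qed

theorem theorem3p33:
  fixes n e :: nat
  assumes "n > 0"
    and "e = multiplicity 2 n"
  shows "r_G n = 2 * (\<Sum>d | d dvd n \<and> odd d. d) *
    (if e = 0 then 1 else if e = 1 then 2 else if e = 2 then 4 else 12)"
proof -
  obtain m where n: "n = 2 ^ e * m" and m: "odd m"
    using multiplicity_decompose'[of n 2] assms by auto
  have divs: "{d. d dvd n \<and> odd d} = {d. d dvd m}"
    using m by (auto simp: n coprime_dvd_mult_right_iff elim: dvd_trans)
  have card_m: "card (four_squares (int m)) = 8 * (\<Sum>d | d dvd m. d)"
  proof -
    have "int (card (four_squares (int m))) = int (8 * (\<Sum>d | d dvd m. d))"
      using card_four_squares_odd[of "int m"] sum_odd_factorizations[OF m] m by simp
    then show ?thesis by (simp only: of_nat_eq_iff)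
  qed
  \<comment> \<open>With r(m) = 8 s(m), the lattice count is r(m)/4, r(m)/2, r(m) and 3 r(m) in
    these cases, that is, 2 s(m) times 1, 2, 4 and 12. For e >= 3 the quotient n/4 is still even,
    whence the factor 3.\<close>
  consider "e = 0" | "e = 1" | "e = 2" | j where "e = Suc j + 2"
    by (metis One_nat_def Suc_1 add_2_eq_Suc' not0_implies_Suc)
  then show ?thesis
  proof cases
    case 1
    then show ?thesis using r_G_odd[OF m] card_m divs by (simp add: n)
  next
    case 2
    then show ?thesis using r_G_double_odd[OF m] card_m divs by (simp add: n)
  next
    case 3
    then show ?thesis using r_G_quadruple[of m] card_m divs by (simp add: n)
  next
    case (4 j)
    then have "n = 4 * (2 ^ Suc j * m)" by (simp add: n)
    then have "r_G n = card (four_squares (2 ^ Suc j * int m))" 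
      using r_G_quadruple[of "2 ^ Suc j * m"] by simp
    also have "\<dots> = 3 * card (four_squares (int m))"
      by (rule card_four_squares_even) (simp add: m)
    finally show ?thesis using 4 card_m divs by simp
  qed
qed

end
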